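(* Let $t\ge 1$ be an integer and let $\mathcal{DS}(t)$ be the set defined in the context. Define $f(t)=|\mathcal{DS}(t)|$, $g(t)=\sum_{\lambda\in\mathcal{DS}(t)}|MD(\lambda)|$ and $h(t)=\sum_{\lambda\in\mathcal{DS}(t)}|\lambda|$ for $t\ge1$, and set $f(-1)=f(0)=1$, $g(-1)=g(0)=0$, $h(-1)=h(0)=0$. Then: (1) $f(1)=1$, $f(2)=2$, and $f(t)=f(t-1)+f(t-3)$ for all $t\ge 3$; consequently $$\sum_{t\ge0}f(t-1)x^t=\frac{1}{1-x-x^3}.$$ (2) $g(1)=0$, $g(2)=1$, and $$\sum_{t\ge0}g(t-1)x^t=\frac{x^3}{(1-x-x^3)^2}.$$ (3) $h(1)=0$, $h(2)=1$, and $$\sum_{t\ge0}h(t-1)x^t=\frac{(1+4x-x^2+6x^3+4x^4+5x^6)x^3}{(1+x+x^3)(1-x-x^3)^3}.$$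
   Context: A partition $\lambda=(\lambda_1,\dots,\lambda_m)$ is a finite non-increasing sequence of positive integers; $|\lambda|=\sum_i\lambda_i$ is its size; the empty partition $\emptyset$ has size $0$. Its Young diagram has $\lambda_i$ left-justified boxes in row $i$. The hook length of box $(i,j)$ is the number of boxes to its right in row $i$, plus the number of boxes below it in column $j$, plus one. $\lambda$ is a $t$-core if no hook length is divisible by $t$, and a $(t,t+1)$-core if it is both a $t$-core and a $(t+1)$-core. $\lambda$ is self-conjugate if its Young diagram is symmetric about the main diagonal. The Durfee square size $s(\lambda)$ is the largest $s$ such that $\lambda$ has at least $s$ parts $\ge s$. $MD(\lambda)$ denotes the set of hook lengths of the main-diagonal boxes $(i,i)$, $1\le i\le s(\lambda)$ (so $|MD(\lambda)|=s(\lambda)$, and $MD(\emptyset)=\emptyset$). $\mathcal{DS}(t)$ is the set of self-conjugate $(t,t+1)$-core partitions $\lambda$ whose first $s(\lambda)$ parts $\lambda_1,\dots,\lambda_{s(\lambda)}$ are pairwise distinct; by convention $\emptyset\in\mathcal{DS}(t)$. *)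

theory Defs
  imports "HOL-Computational_Algebra.Formal_Power_Series"
begin

definition is_partition :: "nat list \<Rightarrow> bool" where
  "is_partition \<mu> \<longleftrightarrow> sorted_wrt (\<ge>) \<mu> \<and> (\<forall>p\<in>set \<mu>. p > 0)"

definition partition_size :: "nat list \<Rightarrow> nat" where
  "partition_size \<mu> = sum_list \<mu>"

(* Boxes are indexed from 0: the box (i, j) here is the box (i + 1, j + 1) of the diagram. *)
definition young_diagram :: "nat list \<Rightarrow> (nat \<times> nat) set" where
  "young_diagram \<mu> = {(i, j). i < length \<mu> \<and> j < \<mu> ! i}"

definition hook_length :: "nat list \<Rightarrow> nat \<Rightarrow> nat \<Rightarrow> nat" where
  "hook_length \<mu> i j =
     card {j'. j < j' \<and> (i, j') \<in> young_diagram \<mu>} +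
     card {i'. i < i' \<and> (i', j) \<in> young_diagram \<mu>} + 1"

definition is_core :: "nat \<Rightarrow> nat list \<Rightarrow> bool" where
  "is_core t \<mu> \<longleftrightarrow> (\<forall>(i, j)\<in>young_diagram \<mu>. \<not> t dvd hook_length \<mu> i j)"

definition self_conjugate :: "nat list \<Rightarrow> bool" where
  "self_conjugate \<mu> \<longleftrightarrow>
     (\<forall>i j. (i, j) \<in> young_diagram \<mu> \<longleftrightarrow> (j, i) \<in> young_diagram \<mu>)"

definition durfee :: "nat list \<Rightarrow> nat" where
  "durfee \<mu> = (GREATEST s. s \<le> length (filter (\<lambda>p. p \<ge> s) \<mu>))"

definition MD :: "nat list \<Rightarrow> nat set" where
  "MD \<mu> = (\<lambda>i. hook_length \<mu> i i) ` {..<durfee \<mu>}"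

definition DS :: "nat \<Rightarrow> nat list set" where
  "DS t = {\<mu>. is_partition \<mu> \<and> self_conjugate \<mu> \<and> is_core t \<mu> \<and> is_core (t + 1) \<mu> \<and>
              distinct (take (durfee \<mu>) \<mu>)}"

lemma Nil_in_DS: "[] \<in> DS t"
  by (simp add: DS_def is_partition_def self_conjugate_def is_core_def young_diagram_def)

(* The conventional values at -1 and 0 are built in; arguments below -1 are never used. *)
definition f_DS :: "int \<Rightarrow> nat" where
  "f_DS t = (if t \<ge> 1 then card (DS (nat t)) else 1)"

definition g_DS :: "int \<Rightarrow> nat" where
  "g_DS t = (if t \<ge> 1 then (\<Sum>\<mu>\<in>DS (nat t). card (MD \<mu>)) else 0)"

definition h_DS :: "int \<Rightarrow> nat" where
  "h_DS t = (if t \<ge> 1 then (\<Sum>\<mu>\<in>DS (nat t). partition_size \<mu>) else 0)"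

end

theory Submission
  imports Defs
begin

text \<open>
  For a self-conjugate partition put \<open>b\<^sub>i = \<mu>\<^sub>i - i - 1\<close> (rows counted from 0, \<open>\<mu>\<close> padded with zeros).
  The hook length of the box \<open>(i, j)\<close> is \<open>b\<^sub>i + b\<^sub>j + 1\<close>, and \<open>(i, j)\<close> is a box iff \<open>b\<^sub>i + b\<^sub>j \<ge> 0\<close>.
  The partition is determined by its set \<open>A\<close> of nonnegative \<open>b\<^sub>i\<close>, the arm lengths of the diagonal
  boxes, and every finite set occurs; moreover a number \<open>c \<notin> A\<close> yields some \<open>b\<^sub>j = -1 - c\<close>.
  If the partition is a \<open>t\<close>- and \<open>(t + 1)\<close>-core and \<open>a \<in> A\<close> with \<open>a \<ge> t\<close>, then \<open>a - t \<in> A\<close>. For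
  \<open>a = t\<close> the two elements \<open>t\<close> and \<open>0\<close> of \<open>A\<close> produce a hook of length \<open>t + 1\<close>; for \<open>a > t\<close> also
  \<open>a - t - 1\<close> lies in \<open>A\<close>, contradicting distinctness of the first parts, which says that \<open>A\<close>
  contains no two consecutive integers. So the condition becomes: \<open>A \<subseteq> {0..<t}\<close> has no two
  consecutive elements and no two (possibly equal) elements with sum \<open>t - 1\<close> or \<open>t\<close>.

  Listing \<open>{0..<t}\<close> as \<open>0, t - 1, 1, t - 2, 2, \<dots>\<close> turns this into: the positions used
  are less than \<open>t - 1\<close> and pairwise differ by at least 3. Splitting such sets by whether they use
  the last position gives the recurrence, and weighting it gives the generating functions.
  The weight needed for the size depends on the parity of the position, which introduces the
  factor \<open>1 + x + x\<^sup>3\<close>, the denominator at \<open>-x\<close>; its dependence on \<open>t\<close> introduces a derivative.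
\<close>

unbundle fps_syntax

section \<open>Contents and diagonal arms of self-conjugate partitions\<close>

definition row :: "nat list \<Rightarrow> nat \<Rightarrow> nat" where
  "row \<mu> i = (if i < length \<mu> then \<mu> ! i else 0)"

lemma young_diagram_iff: "(i, j) \<in> young_diagram \<mu> \<longleftrightarrow> j < row \<mu> i"
  by (auto simp: young_diagram_def row_def)

lemma row_antimono: "is_partition \<mu> \<Longrightarrow> i \<le> j \<Longrightarrow> row \<mu> j \<le> row \<mu> i"
  by (cases "i = j") (auto simp: is_partition_def row_def sorted_wrt_iff_nth_less)

lemma row_pos_iff: "is_partition \<mu> \<Longrightarrow> 0 < row \<mu> i \<longleftrightarrow> i < length \<mu>"
  by (auto simp: is_partition_def row_def)

lemma row_eqI:
  assumes "is_partition \<mu>" "is_partition \<nu>" "\<And>i. row \<mu> i = row \<nu> i"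
  shows "\<mu> = \<nu>"
proof (rule nth_equalityI)
  have "i < length \<mu> \<longleftrightarrow> i < length \<nu>" for i
    using assms row_pos_iff by metis
  then show len: "length \<mu> = length \<nu>" by (metis linorder_neqE_nat less_irrefl)
  show "\<mu> ! i = \<nu> ! i" if "i < length \<mu>" for i
    using assms(3)[of i] that len by (simp add: row_def)
qed

definition sc_partition :: "nat list \<Rightarrow> bool" where
  "sc_partition \<mu> \<longleftrightarrow> is_partition \<mu> \<and> self_conjugate \<mu>"

lemma sc_row_swap: "sc_partition \<mu> \<Longrightarrow> j < row \<mu> i \<longleftrightarrow> i < row \<mu> j"
  by (simp add: sc_partition_def self_conjugate_def young_diagram_iff)

lemma sc_row_antimono: "sc_partition \<mu> \<Longrightarrow> i \<le> j \<Longrightarrow> row \<mu> j \<le> row \<mu> i"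
  by (simp add: sc_partition_def row_antimono)

definition content :: "nat list \<Rightarrow> nat \<Rightarrow> int" where
  "content \<mu> i = int (row \<mu> i) - int i - 1"

lemma content_diff:
  assumes "sc_partition \<mu>" "i \<le> j"
  shows "content \<mu> j + int (j - i) \<le> content \<mu> i"
  using sc_row_antimono[OF assms] assms(2) by (simp add: content_def)

text \<open>By symmetry \<open>j < row \<mu> i\<close> and \<open>i < row \<mu> j\<close> hold or
  fail together, so the sum of contents is at least 0 for a box and at most -2 otherwise; it is
  never -1.\<close>

lemma in_diagram_iff_content:
  assumes "sc_partition \<mu>"
  shows "j < row \<mu> i \<longleftrightarrow> 0 \<le> content \<mu> i + content \<mu> j"
  using sc_row_swap[OF assms, of j i] by (auto simp: content_def)

lemma hook_length_content:
  assumes sc: "sc_partition \<mu>" and box: "j < row \<mu> i"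
  shows "int (hook_length \<mu> i j) = content \<mu> i + content \<mu> j + 1"
proof -
  have "{j'. j < j' \<and> j' < row \<mu> i} = {j<..<row \<mu> i}"
    and "{i'. i < i' \<and> j < row \<mu> i'} = {i<..<row \<mu> j}"
    by (auto simp: sc_row_swap[OF sc, of j])
  moreover have "i < row \<mu> j" using box sc_row_swap[OF sc] by simp
  ultimately show ?thesis using box
    by (simp add: hook_length_def young_diagram_iff content_def)
qed

lemma is_core_iff_content:
  assumes sc: "sc_partition \<mu>"
  shows "is_core t \<mu> \<longleftrightarrow> (\<forall>i j. 0 \<le> content \<mu> i + content \<mu> j \<longrightarrow>
    \<not> int t dvd content \<mu> i + content \<mu> j + 1)"
proof -
  have "is_core t \<mu> \<longleftrightarrow> (\<forall>i j. j < row \<mu> i \<longrightarrow> \<not> int t dvd int (hook_length \<mu> i j))"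
    unfolding is_core_def by (auto simp: young_diagram_iff)
  then show ?thesis
    using hook_length_content[OF sc] in_diagram_iff_content[OF sc] by metis
qed

definition arms :: "nat list \<Rightarrow> nat set" where
  "arms \<mu> = {a. \<exists>i. int a = content \<mu> i}"

lemma arms_alt: "arms \<mu> = (\<lambda>i. row \<mu> i - Suc i) ` {i. i < row \<mu> i}"
proof (intro set_eqI iffI)
  fix a assume "a \<in> arms \<mu>"
  then obtain i where "int a = content \<mu> i" by (auto simp: arms_def)
  then have "i < row \<mu> i" "a = row \<mu> i - Suc i" by (auto simp: content_def)
  then show "a \<in> (\<lambda>i. row \<mu> i - Suc i) ` {i. i < row \<mu> i}" by blast
next
  fix a assume "a \<in> (\<lambda>i. row \<mu> i - Suc i) ` {i. i < row \<mu> i}"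
  then obtain i where "i < row \<mu> i" "a = row \<mu> i - Suc i" by blast
  then have "int a = content \<mu> i" by (simp add: content_def)
  then show "a \<in> arms \<mu>" by (auto simp: arms_def)
qed

lemma finite_arms: "finite (arms \<mu>)"
proof -
  have "{i. i < row \<mu> i} \<subseteq> {..<length \<mu>}" by (auto simp: row_def split: if_splits)
  then show ?thesis unfolding arms_alt by (auto intro: finite_subset)
qed

text \<open>The Maya diagram of a self-conjugate partition is symmetric. Contents \<open>c\<close>
  and \<open>-1 - c\<close> together would have the impossible sum -1; if \<open>c\<close> is
  missing, a row with content \<open>-1 - c\<close> is found.\<close>

lemma content_neg_arm:
  assumes sc: "sc_partition \<mu>"
  shows "(\<exists>i. content \<mu> i = - 1 - int c) \<longleftrightarrow> c \<notin> arms \<mu>"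
proof
  assume "\<exists>i. content \<mu> i = - 1 - int c"
  then obtain j where j: "content \<mu> j = - 1 - int c" by blast
  show "c \<notin> arms \<mu>"
  proof
    assume "c \<in> arms \<mu>"
    then obtain i where i: "content \<mu> i = int c" by (auto simp: arms_def)
    have "content \<mu> i + content \<mu> j = -1" using i j by simp
    then show False
      using sc_row_swap[OF sc, of j i] by (cases "j < row \<mu> i") (auto simp: content_def)
  qed
next
  assume c: "c \<notin> arms \<mu>"
  have "row \<mu> (length \<mu>) \<le> c + length \<mu>" by (simp add: row_def)
  \<comment> \<open>Row \<open>i\<close> is the first with content below \<open>c\<close>. The
    \<open>i\<close> rows before it have content above \<open>c\<close>, since \<open>c\<close> is
    no arm; by symmetry row \<open>c + i\<close> then has exactly \<open>i\<close> boxes.\<close>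
  then obtain i where i: "row \<mu> i \<le> c + i" and least: "\<And>k. k < i \<Longrightarrow> \<not> row \<mu> k \<le> c + k"
    using exists_least_iff[of "\<lambda>i. row \<mu> i \<le> c + i"] by blast
  have "\<not> i < row \<mu> (c + i)" using i sc_row_swap[OF sc, of "c + i" i] by simp
  moreover have "i \<le> row \<mu> (c + i)"
  proof (cases i)
    case (Suc k)
    have "c + k < row \<mu> k" using least[of k] Suc by simp
    moreover have "int c \<noteq> content \<mu> k" using c by (auto simp: arms_def)
    then have "row \<mu> k \<noteq> Suc (c + k)" by (simp add: content_def)
    ultimately have "c + i < row \<mu> k" using Suc by simp
    then show ?thesis using sc_row_swap[OF sc, of "c + i" k] Suc by simp
  qed simp
  ultimately have "content \<mu> (c + i) = - 1 - int c" by (simp add: content_def)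
  then show "\<exists>i. content \<mu> i = - 1 - int c" by blast
qed

section \<open>Durfee square, diagonal hooks and distinct first parts\<close>

lemma durfee_iff:
  assumes "is_partition \<mu>"
  shows "i < durfee \<mu> \<longleftrightarrow> i < row \<mu> i"
proof -
  have card: "length (filter (\<lambda>p. s \<le> p) \<mu>) = card {i. i < length \<mu> \<and> s \<le> \<mu> ! i}" for s
    by (simp add: length_filter_conv_card)
  \<comment> \<open>The parts of size at least \<open>s\<close> fill the first rows, so having
    \<open>s\<close> of them means that the first \<open>s\<close> diagonal boxes are present, a
    condition closed downwards in \<open>s\<close>.\<close>
  have P: "s \<le> length (filter (\<lambda>p. s \<le> p) \<mu>) \<longleftrightarrow> (\<forall>i<s. i < row \<mu> i)" for s
  proof
    assume s: "s \<le> length (filter (\<lambda>p. s \<le> p) \<mu>)"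
    show "\<forall>i<s. i < row \<mu> i"
    proof (rule ccontr)
      assume "\<not> (\<forall>i<s. i < row \<mu> i)"
      then obtain i where i: "i < s" "row \<mu> i \<le> i" by force
      have "{k. k < length \<mu> \<and> s \<le> \<mu> ! k} \<subseteq> {..<i}"
      proof
        fix k assume "k \<in> {k. k < length \<mu> \<and> s \<le> \<mu> ! k}"
        then have "s \<le> row \<mu> k" by (simp add: row_def)
        then show "k \<in> {..<i}" using i row_antimono[OF assms, of i k] by (cases "k < i") auto
      qed
      then have "card {k. k < length \<mu> \<and> s \<le> \<mu> ! k} \<le> i"
        using card_mono[of "{..<i}"] by fastforce
      then show False using s i card by simp
    qed
  next
    assume r: "\<forall>i<s. i < row \<mu> i"
    have "{..<s} \<subseteq> {k. k < length \<mu> \<and> s \<le> \<mu> ! k}"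
    proof
      fix k assume k: "k \<in> {..<s}"
      then have "s - 1 < row \<mu> (s - 1)" using r by simp
      also have "\<dots> \<le> row \<mu> k" using row_antimono[OF assms, of k "s - 1"] k by auto
      finally show "k \<in> {k. k < length \<mu> \<and> s \<le> \<mu> ! k}" by (auto simp: row_def split: if_splits)
    qed
    then have "card {..<s} \<le> card {k. k < length \<mu> \<and> s \<le> \<mu> ! k}"
      by (intro card_mono) auto
    then show "s \<le> length (filter (\<lambda>p. s \<le> p) \<mu>)" using card by simp
  qed
  have bd: "s \<le> length \<mu>" if "\<forall>i<s. i < row \<mu> i" for s
    using that P[of s] length_filter_le[of "\<lambda>p. s \<le> p" \<mu>] le_trans by blast
  have d: "durfee \<mu> = (GREATEST s. \<forall>i<s. i < row \<mu> i)"
    unfolding durfee_def P ..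
  have G: "\<forall>i<durfee \<mu>. i < row \<mu> i"
    unfolding d by (rule GreatestI_nat[of "\<lambda>s. \<forall>i<s. i < row \<mu> i" 0 "length \<mu>"]) (use bd in auto)
  show ?thesis
  proof
    assume i: "i < row \<mu> i"
    have "k < row \<mu> k" if "k < Suc i" for k
      using row_antimono[OF assms, of k i] i that by simp
    then have "Suc i \<le> durfee \<mu>"
      unfolding d
      by (intro Greatest_le_nat[of "\<lambda>s. \<forall>i<s. i < row \<mu> i" _ "length \<mu>"]) (use bd in auto)
    then show "i < durfee \<mu>" by simp
  qed (use G in blast)
qed

lemma card_MD:
  assumes sc: "sc_partition \<mu>"
  shows "card (MD \<mu>) = card (arms \<mu>)"
proof -
  have part: "is_partition \<mu>" using sc by (simp add: sc_partition_def)
  have d: "{..<durfee \<mu>} = {i. i < row \<mu> i}" using durfee_iff[OF part] by auto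
  have "hook_length \<mu> i i = 2 * (row \<mu> i - Suc i) + 1" if "i < row \<mu> i" for i
    using hook_length_content[OF sc that] that by (simp add: content_def)
  then have "MD \<mu> = (\<lambda>a. 2 * a + 1) ` arms \<mu>"
    unfolding MD_def d arms_alt image_image by (intro image_cong) auto
  then show ?thesis by (simp add: card_image inj_on_def)
qed

text \<open>Adjacent rows of equal length have contents differing by exactly 1. Contents strictly
  decrease, so consecutive arms can only come from adjacent rows.\<close>

lemma distinct_take_durfee_iff:
  assumes sc: "sc_partition \<mu>"
  shows "distinct (take (durfee \<mu>) \<mu>) \<longleftrightarrow> (\<forall>a\<in>arms \<mu>. Suc a \<notin> arms \<mu>)"
proof -
  have part: "is_partition \<mu>" using sc by (simp add: sc_partition_def)
  have len: "i < length \<mu>" if "i < durfee \<mu>" for i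
    using that durfee_iff[OF part, of i] by (auto simp: row_def split: if_splits)
  then have dl: "durfee \<mu> \<le> length \<mu>" by (meson not_less less_irrefl)
  have D: "distinct (take (durfee \<mu>) \<mu>) \<longleftrightarrow>
      (\<forall>i<durfee \<mu>. \<forall>j<durfee \<mu>. i \<noteq> j \<longrightarrow> row \<mu> i \<noteq> row \<mu> j)"
    using len dl by (auto simp: distinct_conv_nth row_def min_def)
  show ?thesis
  proof
    assume dist: "distinct (take (durfee \<mu>) \<mu>)"
    show "\<forall>a\<in>arms \<mu>. Suc a \<notin> arms \<mu>"
    proof (intro ballI notI)
      fix a assume "a \<in> arms \<mu>" "Suc a \<in> arms \<mu>"
      then obtain i j where "int a = content \<mu> i" "int (Suc a) = content \<mu> j"
        unfolding arms_def by blast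
      then have ij: "content \<mu> i = int a" "content \<mu> j = int a + 1" by auto
      have "j \<le> i" using content_diff[OF sc, of i j] ij by (cases "i \<le> j") auto
      then have "i = Suc j" using content_diff[OF sc, of j i] ij by (cases "i = j") auto
      then have "row \<mu> i = row \<mu> j" using ij by (simp add: content_def)
      moreover have "i < durfee \<mu>" "j < durfee \<mu>"
        using ij by (auto simp: durfee_iff[OF part] content_def)
      ultimately show False using dist D \<open>i = Suc j\<close> by auto
    qed
  next
    assume R: "\<forall>a\<in>arms \<mu>. Suc a \<notin> arms \<mu>"
    have "row \<mu> i \<noteq> row \<mu> j" if "i < j" "j < durfee \<mu>" for i j
    proof
      assume eq: "row \<mu> i = row \<mu> j"
      have "row \<mu> (Suc i) = row \<mu> i"
        using eq sc_row_antimono[OF sc, of i "Suc i"] sc_row_antimono[OF sc, of "Suc i" j] that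
        by simp
      moreover have "Suc i < row \<mu> (Suc i)" using that durfee_iff[OF part, of "Suc i"] by simp
      ultimately have "int (row \<mu> i - Suc (Suc i)) = content \<mu> (Suc i)"
        "int (Suc (row \<mu> i - Suc (Suc i))) = content \<mu> i"
        by (auto simp: content_def)
      then show False using R unfolding arms_def by blast
    qed
    then show "distinct (take (durfee \<mu>) \<mu>)"
      unfolding D by (metis linorder_neqE_nat)
  qed
qed

section \<open>Simultaneous cores in terms of arms\<close>

definition admissible :: "nat \<Rightarrow> nat set \<Rightarrow> bool" where
  "admissible t A \<longleftrightarrow> A \<subseteq> {..<t} \<and> (\<forall>a\<in>A. Suc a \<notin> A) \<and>
     (\<forall>a\<in>A. \<forall>b\<in>A. a + b \<noteq> t \<and> Suc (a + b) \<noteq> t)"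

lemma DS_iff_admissible:
  assumes "t \<ge> 1"
  shows "\<mu> \<in> DS t \<longleftrightarrow> sc_partition \<mu> \<and> admissible t (arms \<mu>)"
proof (cases "sc_partition \<mu>")
  case False
  then show ?thesis by (auto simp: DS_def sc_partition_def)
next
  case sc: True
  have core_bad: "\<not> is_core k \<mu>" if "a \<in> arms \<mu>" "b \<in> arms \<mu>" "Suc (a + b) = k" for a b k
  proof -
    from that obtain i j where "content \<mu> i = int a" "content \<mu> j = int b"
      by (auto simp: arms_def)
    with that(3) have "0 \<le> content \<mu> i + content \<mu> j" "content \<mu> i + content \<mu> j + 1 = int k"
      by auto
    then show ?thesis unfolding is_core_iff_content[OF sc] by (metis dvd_refl)
  qed
  \<comment> \<open>If \<open>a - k\<close> is missing, the content \<open>-1 - (a - k)\<close>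
    occurs and pairs with \<open>a\<close> to a hook of length exactly \<open>k\<close>.\<close>
  have core_step: "a - k \<in> arms \<mu>" 
    if core: "is_core k \<mu>" and a: "a \<in> arms \<mu>" and k: "k \<le> a" "k > 0" for a k
  proof (rule ccontr)
    assume "a - k \<notin> arms \<mu>"
    then obtain j where j: "content \<mu> j = - 1 - int (a - k)"
      using content_neg_arm[OF sc] by blast
    obtain i where "content \<mu> i = int a" using a by (auto simp: arms_def)
    with j k have "0 \<le> content \<mu> i + content \<mu> j" "content \<mu> i + content \<mu> j + 1 = int k"
      by auto
    then show False using core unfolding is_core_iff_content[OF sc] by (metis dvd_refl)
  qed
  \<comment> \<open>All contents are below \<open>t \<le> k\<close>, so hooks are shorter than
    \<open>2 * k\<close>, and one divisible by \<open>k\<close> has length \<open>k\<close>. Its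
    smaller content is then nonnegative, so both contents are arms.\<close>
  have coreI: "is_core k \<mu>" if A: "arms \<mu> \<subseteq> {..<t}" and k: "t \<le> k"
    and nk: "\<forall>a\<in>arms \<mu>. \<forall>b\<in>arms \<mu>. Suc (a + b) \<noteq> k" for k
  proof -
    have key: "\<not> int k dvd content \<mu> i + content \<mu> j + 1"
      if nn: "0 \<le> content \<mu> i + content \<mu> j" and ji: "content \<mu> j \<le> content \<mu> i" for i j
    proof
      assume "int k dvd content \<mu> i + content \<mu> j + 1"
      then obtain m where m: "content \<mu> i + content \<mu> j + 1 = int k * m" by (auto elim: dvdE)
      then have "m > 0" using nn k assms by (smt (verit) mult_nonneg_nonpos of_nat_0_le_iff)
      have "0 \<le> content \<mu> i" using nn ji by simp
      then obtain a where a: "content \<mu> i = int a" using nonneg_int_cases by metis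
      have aA: "a \<in> arms \<mu>" unfolding arms_def using a[symmetric] by blast
      then have "a < t" using A by auto
      have "int a < int k" using \<open>a < t\<close> k by simp
      then have "int k * m < int k * 2" using m a ji by linarith
      then have "m < 2" using mult_less_cancel_left_pos[of "int k" m 2] k assms by simp
      then have "m = 1" using \<open>m > 0\<close> by simp
      then have s: "content \<mu> i + content \<mu> j + 1 = int k" using m by simp
      then have "0 \<le> content \<mu> j" using a \<open>a < t\<close> k by simp
      then obtain b where b: "content \<mu> j = int b" using nonneg_int_cases by metis
      have "b \<in> arms \<mu>" unfolding arms_def using b[symmetric] by blast
      moreover have "Suc (a + b) = k" using s a b by linarith
      ultimately show False using nk aA by blast
    qed
    show ?thesis unfolding is_core_iff_content[OF sc]
      using key by (metis add.commute linorder_le_cases)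
  qed
  have "arms \<mu> \<subseteq> {..<t}" if c1: "is_core t \<mu>" and c2: "is_core (t + 1) \<mu>"
    and nc: "\<forall>a\<in>arms \<mu>. Suc a \<notin> arms \<mu>"
  proof
    fix a assume a: "a \<in> arms \<mu>"
    show "a \<in> {..<t}"
    proof (rule ccontr)
      assume "a \<notin> {..<t}"
      then have "t \<le> a" by simp
      then have at: "a - t \<in> arms \<mu>" using core_step[OF c1 a] assms by simp
      show False
      proof (cases "a = t")
        case True
        then show False using core_bad[of a "a - t" "t + 1"] a at c2 by simp
      next
        case False
        then have "a - (t + 1) \<in> arms \<mu>" using core_step[OF c2 a] \<open>t \<le> a\<close> by simp
        moreover have "Suc (a - (t + 1)) = a - t" using False \<open>t \<le> a\<close> by simp
        ultimately show False using nc at by metis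
      qed
    qed
  qed
  moreover have "\<mu> \<in> DS t \<longleftrightarrow> is_core t \<mu> \<and> is_core (t + 1) \<mu> \<and> (\<forall>a\<in>arms \<mu>. Suc a \<notin> arms \<mu>)"
    using sc distinct_take_durfee_iff[OF sc] by (auto simp: DS_def sc_partition_def)
  moreover have "a + b \<noteq> t" if "is_core (t + 1) \<mu>" "a \<in> arms \<mu>" "b \<in> arms \<mu>" for a b
    using core_bad[of a b "t + 1"] that by auto
  moreover have "Suc (a + b) \<noteq> t" if "is_core t \<mu>" "a \<in> arms \<mu>" "b \<in> arms \<mu>" for a b
    using core_bad[of a b t] that by auto
  moreover have "is_core t \<mu>" "is_core (t + 1) \<mu>" if "admissible t (arms \<mu>)"
    using coreI[of t] coreI[of "t + 1"] that by (auto simp: admissible_def)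
  ultimately show ?thesis using sc unfolding admissible_def by blast
qed

section \<open>Self-conjugate partitions as nested diagonal hooks\<close>

text \<open>For \<open>length \<mu> \<le> a\<close> this adds an outermost diagonal hook with arm
  and leg \<open>a\<close>: the old diagram moves one step along the diagonal, and the ones complete
  the first column.\<close>

definition wrap_hook :: "nat \<Rightarrow> nat list \<Rightarrow> nat list" where
  "wrap_hook a \<mu> = Suc a # map Suc \<mu> @ replicate (a - length \<mu>) 1"

lemma sc_row_0: "sc_partition \<mu> \<Longrightarrow> row \<mu> 0 = length \<mu>"
  using sc_row_swap[of \<mu> _ 0] row_pos_iff[of \<mu>]
  by (metis linorder_neqE_nat less_irrefl sc_partition_def)

lemma row_wrap_hook_0: "row (wrap_hook a \<mu>) 0 = Suc a"
  by (simp add: wrap_hook_def row_def)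

lemma row_wrap_hook_Suc:
  "length \<mu> \<le> a \<Longrightarrow> row (wrap_hook a \<mu>) (Suc i) = (if i < a then Suc (row \<mu> i) else 0)"
  by (auto simp: wrap_hook_def row_def nth_append)

lemma sc_partition_wrap_hook:
  assumes sc: "sc_partition \<mu>" and len: "length \<mu> \<le> a"
  shows "sc_partition (wrap_hook a \<mu>)"
proof -
  have part: "is_partition \<mu>" using sc by (simp add: sc_partition_def)
  have "p \<le> a" if "p \<in> set \<mu>" for p
  proof -
    obtain i where "i < length \<mu>" "p = row \<mu> i"
      using \<open>p \<in> set \<mu>\<close> by (auto simp: in_set_conv_nth row_def)
    then show ?thesis using sc_row_antimono[OF sc, of 0 i] sc_row_0[OF sc] len by simp
  qed
  moreover have "sorted_wrt (\<ge>) (replicate n (1::nat))" for n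
    by (simp add: sorted_wrt_iff_nth_less)
  ultimately have "is_partition (wrap_hook a \<mu>)"
    using part by (auto simp: is_partition_def wrap_hook_def sorted_wrt_append sorted_wrt_map)
  moreover have bound: "i < a \<and> j < a" if "i < row \<mu> j" for i j
  proof -
    have "i < row \<mu> 0" using that sc_row_antimono[OF sc, of 0 j] by simp
    moreover have "j < length \<mu>" using that by (auto simp: row_def split: if_splits)
    ultimately show ?thesis using sc_row_0[OF sc] len by simp
  qed
  have "j < row (wrap_hook a \<mu>) i \<longleftrightarrow> i < row (wrap_hook a \<mu>) j" for i j
    using sc_row_swap[OF sc, of "j - 1" "i - 1"]
    by (cases i; cases j) (auto simp: row_wrap_hook_0 row_wrap_hook_Suc[OF len] dest: bound)
  ultimately show ?thesis
    by (simp add: sc_partition_def self_conjugate_def young_diagram_iff)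
qed

lemma sc_partition_unwrap:
  assumes sc: "sc_partition \<mu>" and ne: "\<mu> \<noteq> []"
  obtains a \<nu> where "sc_partition \<nu>" "length \<nu> \<le> a" "\<mu> = wrap_hook a \<nu>"
proof -
  have part: "is_partition \<mu>" using sc by (simp add: sc_partition_def)
  \<comment> \<open>The first row and column are deleted. By symmetry \<open>row \<mu> 1\<close>
    counts the rows with at least two boxes, so \<open>row \<mu> 1 - 1\<close> rows survive;
    truncation covers the single box.\<close>
  define \<nu> where "\<nu> = map (\<lambda>i. row \<mu> (Suc i) - 1) [0..<row \<mu> 1 - 1]"
  define a where "a = row \<mu> 0 - 1"
  have pos: "row \<mu> 0 > 0" using ne row_pos_iff[OF part] by simp
  have row: "row \<nu> i = row \<mu> (Suc i) - 1" for i
    using sc_row_swap[OF sc, of 1 "Suc i"] by (auto simp: row_def[of "map _ _"] \<nu>_def)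
  have len: "length \<nu> \<le> a"
    using sc_row_antimono[OF sc, of 0 1] by (simp add: \<nu>_def a_def)
  have "is_partition \<nu>"
    unfolding is_partition_def
  proof
    show "sorted_wrt (\<ge>) \<nu>"
      using sc_row_antimono[OF sc]
      by (auto simp: \<nu>_def sorted_wrt_iff_nth_less intro!: diff_le_mono)
    show "\<forall>p\<in>set \<nu>. 0 < p"
    proof
      fix p assume "p \<in> set \<nu>"
      then obtain i where "p = row \<mu> (Suc i) - 1" "Suc i < row \<mu> 1" by (auto simp: \<nu>_def)
      then show "0 < p" using sc_row_swap[OF sc, of 1 "Suc i"] by simp
    qed
  qed
  moreover have "j < row \<nu> i \<longleftrightarrow> i < row \<nu> j" for i j
    using sc_row_swap[OF sc, of "Suc j" "Suc i"] unfolding row by auto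
  ultimately have sc\<nu>: "sc_partition \<nu>"
    by (simp add: sc_partition_def self_conjugate_def young_diagram_iff)
  have "row \<mu> i = row (wrap_hook a \<nu>) i" for i
  proof (cases i)
    case 0
    then show ?thesis using pos by (simp add: row_wrap_hook_0 a_def)
  next
    case (Suc k)
    show ?thesis
      using sc_row_swap[OF sc, of 0 "Suc k"]
      unfolding Suc row_wrap_hook_Suc[OF len] row by (auto simp: a_def)
  qed
  then have "\<mu> = wrap_hook a \<nu>"
    using row_eqI[OF part] sc_partition_wrap_hook[OF sc\<nu> len] by (simp add: sc_partition_def)
  with sc\<nu> len show ?thesis using that by blast
qed

lemma sc_partition_Nil: "sc_partition []"
  by (simp add: sc_partition_def is_partition_def self_conjugate_def young_diagram_def)

lemma sc_partition_induct [consumes 1, case_names Nil wrap]: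
  assumes "sc_partition \<mu>" and "P []"
    and "\<And>a \<mu>. sc_partition \<mu> \<Longrightarrow> length \<mu> \<le> a \<Longrightarrow> P \<mu> \<Longrightarrow> P (wrap_hook a \<mu>)"
  shows "P \<mu>"
  using assms(1)
proof (induction "length \<mu>" arbitrary: \<mu> rule: less_induct)
  case less
  show ?case
  proof (cases "\<mu> = []")
    case False
    then obtain a \<nu> where \<nu>: "sc_partition \<nu>" "length \<nu> \<le> a" "\<mu> = wrap_hook a \<nu>"
      using sc_partition_unwrap less.prems by metis
    then have "length \<nu> < length \<mu>" by (simp add: wrap_hook_def)
    then show ?thesis using less.hyps \<nu> assms(3) by simp
  qed (use assms(2) in simp)
qed

lemma arms_Nil: "arms [] = {}"
  by (auto simp: arms_def content_def row_def)

lemma arms_wrap_hook: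
  assumes "length \<mu> \<le> a"
  shows "arms (wrap_hook a \<mu>) = insert a (arms \<mu>)"
proof -
  have c0: "content (wrap_hook a \<mu>) 0 = int a"
    by (simp add: content_def row_wrap_hook_0)
  \<comment> \<open>For \<open>i < a\<close> length and index both grow by one, so the content is
    kept. For \<open>i \<ge> a\<close> it changes but stays negative, hence the comparison with
    \<open>int b\<close> only.\<close>
  have cS: "int b = content (wrap_hook a \<mu>) (Suc i) \<longleftrightarrow> int b = content \<mu> i" for b i
    using assms by (auto simp: content_def row_wrap_hook_Suc[OF assms] row_def[of \<mu>])
  show ?thesis
  proof (intro set_eqI iffI)
    fix b assume "b \<in> arms (wrap_hook a \<mu>)"
    then obtain i where i: "int b = content (wrap_hook a \<mu>) i" by (auto simp: arms_def)
    show "b \<in> insert a (arms \<mu>)"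
    proof (cases i)
      case 0
      then show ?thesis using i c0 by simp
    next
      case (Suc k)
      then have "int b = content \<mu> k" using i cS by blast
      then show ?thesis unfolding arms_def by blast
    qed
  next
    fix b assume "b \<in> insert a (arms \<mu>)"
    then show "b \<in> arms (wrap_hook a \<mu>)"
      using c0[symmetric] cS unfolding arms_def by blast
  qed
qed

lemma arms_less_length:
  assumes "sc_partition \<mu>" "a \<in> arms \<mu>"
  shows "a < length \<mu>"
proof -
  from assms(2) obtain i where "int a = content \<mu> i" by (auto simp: arms_def)
  then show ?thesis
    using sc_row_antimono[OF assms(1), of 0 i] sc_row_0[OF assms(1)] by (simp add: content_def)
qed

lemma length_pred_in_arms:
  assumes "sc_partition \<mu>" "\<mu> \<noteq> []"
  shows "length \<mu> - 1 \<in> arms \<mu>"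
proof -
  have "int (length \<mu> - 1) = content \<mu> 0"
    using assms by (cases \<mu>) (auto simp: content_def sc_row_0)
  then show ?thesis unfolding arms_def by blast
qed

text \<open>Each wrapping adds \<open>a + 1\<close> boxes in the first row and \<open>a\<close> more
  in the first column.\<close>

lemma partition_size_arms:
  "sc_partition \<mu> \<Longrightarrow> partition_size \<mu> = (\<Sum>a\<in>arms \<mu>. 2 * a + 1)"
proof (induction rule: sc_partition_induct)
  case Nil
  then show ?case by (simp add: partition_size_def arms_Nil)
next
  case (wrap a \<mu>)
  have "a \<notin> arms \<mu>" using arms_less_length[OF wrap(1)] wrap(2) by fastforce
  moreover have "sum_list (map Suc \<mu>) = sum_list \<mu> + length \<mu>" by (induction \<mu>) auto
  ultimately show ?case
    using wrap by (simp add: arms_wrap_hook finite_arms)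
      (simp add: partition_size_def wrap_hook_def sum_list_replicate)
qed

text \<open>The outermost hook is given by the largest arm, so partitions with equal arm sets share
  it; removing it from both leaves equal arm sets again.\<close>

lemma inj_on_arms: "inj_on arms {\<mu>. sc_partition \<mu>}"
proof -
  have "sc_partition \<mu> \<Longrightarrow> \<forall>\<nu>. sc_partition \<nu> \<longrightarrow> arms \<mu> = arms \<nu> \<longrightarrow> \<mu> = \<nu>" for \<mu>
  proof (induction rule: sc_partition_induct)
    case Nil
    then show ?case using length_pred_in_arms arms_Nil by fastforce
  next
    case (wrap a \<mu>)
    show ?case
    proof (intro allI impI)
      fix \<nu> assume \<nu>: "sc_partition \<nu>" and eq: "arms (wrap_hook a \<mu>) = arms \<nu>"
      have "\<nu> \<noteq> []" using eq wrap(2) by (auto simp: arms_wrap_hook arms_Nil)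
      then obtain b \<nu>' where \<nu>': "sc_partition \<nu>'" "length \<nu>' \<le> b" "\<nu> = wrap_hook b \<nu>'"
        using sc_partition_unwrap \<nu> by metis
      have ins: "insert a (arms \<mu>) = insert b (arms \<nu>')"
        using eq \<nu>' wrap(2) by (simp add: arms_wrap_hook)
      have lt: "\<forall>x\<in>arms \<mu>. x < a" "\<forall>x\<in>arms \<nu>'. x < b"
        using arms_less_length wrap(1,2) \<nu>' by fastforce+
      have "a \<le> b" "b \<le> a" using ins lt by (metis insert_iff less_imp_le order_refl)+
      then have "a = b" by simp
      moreover have "arms \<mu> = arms \<nu>'"
        using ins lt \<open>a = b\<close> by (metis insert_ident less_irrefl)
      ultimately show "wrap_hook a \<mu> = \<nu>" using wrap(3) \<nu>' by blast
    qed
  qed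
  then show ?thesis by (auto simp: inj_on_def)
qed

text \<open>Hooks are wrapped in increasing order of arm; the newest exceeds all earlier ones and
  therefore fits around them.\<close>

lemma arms_surj:
  assumes "finite A"
  shows "\<exists>\<mu>. sc_partition \<mu> \<and> arms \<mu> = A"
  using assms
proof (induction rule: finite_linorder_max_induct)
  case empty
  then show ?case using sc_partition_Nil arms_Nil by blast
next
  case (insert a A)
  then obtain \<mu> where \<mu>: "sc_partition \<mu>" "arms \<mu> = A" by blast
  have "length \<mu> \<le> a"
    using length_pred_in_arms[OF \<mu>(1)] \<mu>(2) insert.hyps(2) by (cases \<mu>) auto
  then show ?case using sc_partition_wrap_hook[OF \<mu>(1)] arms_wrap_hook \<mu>(2) by metis
qed

lemma bij_betw_arms:
  assumes "t \<ge> 1"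
  shows "bij_betw arms (DS t) {A. admissible t A}"
  unfolding bij_betw_def
proof
  show "inj_on arms (DS t)"
    by (rule inj_on_subset[OF inj_on_arms]) (use DS_iff_admissible[OF assms] in auto)
  show "arms ` DS t = {A. admissible t A}"
  proof (intro set_eqI iffI)
    fix A assume "A \<in> {A. admissible t A}"
    then have A: "admissible t A" by simp
    then have "finite A" by (auto simp: admissible_def intro: finite_subset)
    then obtain \<mu> where "sc_partition \<mu>" "arms \<mu> = A" using arms_surj by blast
    with A show "A \<in> arms ` DS t" using DS_iff_admissible[OF assms] by blast
  qed (use DS_iff_admissible[OF assms] in auto)
qed

section \<open>Sets with gaps of at least three\<close>

definition sparse_sets :: "nat \<Rightarrow> nat set set" where
  "sparse_sets n = {S. S \<subseteq> {..<n} \<and> (\<forall>p\<in>S. \<forall>q\<in>S. p < q \<longrightarrow> p + 3 \<le> q)}"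

lemma finite_sparse_sets: "finite (sparse_sets n)"
  by (rule finite_subset[of _ "Pow {..<n}"]) (auto simp: sparse_sets_def)

lemma sparse_setsD: "S \<in> sparse_sets n \<Longrightarrow> finite S \<and> (\<forall>p\<in>S. p < n)"
  by (auto simp: sparse_sets_def intro: finite_subset)

lemma sparse_sets_0: "sparse_sets 0 = {{}}"
  by (auto simp: sparse_sets_def)

text \<open>If \<open>n\<close> is used, all other elements are at most \<open>n - 3\<close>. For
  \<open>n < 2\<close> truncation makes \<open>n - 2\<close> zero, leaving only the empty set as
  remainder.\<close>

lemma sparse_sets_Suc: "sparse_sets (Suc n) = sparse_sets n \<union> insert n ` sparse_sets (n - 2)"
proof (intro set_eqI iffI)
  fix S assume S: "S \<in> sparse_sets (Suc n)"
  show "S \<in> sparse_sets n \<union> insert n ` sparse_sets (n - 2)"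
  proof (cases "n \<in> S")
    case False
    have "p < n" if "p \<in> S" for p
      using that False S by (cases "p = n") (auto simp: sparse_sets_def)
    with S show ?thesis by (auto simp: sparse_sets_def)
  next
    case True
    have "p < n - 2" if "p \<in> S - {n}" for p
    proof -
      have "p < n" using that S by (auto simp: sparse_sets_def less_Suc_eq)
      then have "p + 3 \<le> n" using that S True by (auto simp: sparse_sets_def)
      then show ?thesis by simp
    qed
    then have "S - {n} \<in> sparse_sets (n - 2)" using S by (auto simp: sparse_sets_def)
    moreover have "S = insert n (S - {n})" using True by auto
    ultimately show ?thesis by blast
  qed
next
  fix S assume "S \<in> sparse_sets n \<union> insert n ` sparse_sets (n - 2)"
  then show "S \<in> sparse_sets (Suc n)"
    by (force simp: sparse_sets_def)
qed

lemma sum_sparse_sets_Suc: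
  "(\<Sum>S\<in>sparse_sets (Suc n). F S) =
   (\<Sum>S\<in>sparse_sets n. F S) + (\<Sum>S\<in>sparse_sets (n - 2). F (insert n S))"
proof -
  have "inj_on (insert n) (sparse_sets (n - 2))"
    by (rule inj_onI) (use sparse_setsD in \<open>fastforce dest: insert_ident[THEN iffD1, rotated 2]\<close>)
  moreover have "sparse_sets n \<inter> insert n ` sparse_sets (n - 2) = {}"
    by (auto simp: sparse_sets_def)
  ultimately show ?thesis
    by (simp add: sparse_sets_Suc sum.union_disjoint finite_sparse_sets sum.reindex)
qed

section \<open>Recurrences and generating functions\<close>

definition sparse_count :: "nat \<Rightarrow> nat" where
  "sparse_count n = card (sparse_sets n)"

definition sparse_weight :: "(nat \<Rightarrow> rat) \<Rightarrow> nat \<Rightarrow> rat" where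
  "sparse_weight w n = (\<Sum>S\<in>sparse_sets n. \<Sum>p\<in>S. w p)"

lemma sparse_count_0: "sparse_count 0 = 1"
  by (simp add: sparse_count_def sparse_sets_0)

lemma sparse_count_Suc: "sparse_count (Suc n) = sparse_count n + sparse_count (n - 2)"
  using sum_sparse_sets_Suc[of "\<lambda>_. 1 :: nat" n] by (simp add: sparse_count_def)

lemma sparse_weight_0: "sparse_weight w 0 = 0"
  by (simp add: sparse_weight_def sparse_sets_0)

lemma sparse_weight_Suc:
  "sparse_weight w (Suc n) =
   sparse_weight w n + sparse_weight w (n - 2) + w n * of_nat (sparse_count (n - 2))"
proof -
  have "(\<Sum>p\<in>insert n S. w p) = (\<Sum>p\<in>S. w p) + w n" if "S \<in> sparse_sets (n - 2)" for S
    using sparse_setsD[OF that] by (subst sum.insert) auto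
  then show ?thesis
    unfolding sparse_weight_def sum_sparse_sets_Suc
    by (simp add: sum.distrib sparse_count_def)
qed

text \<open>The shift by two, truncated at zero, absorbs the conventional values at \<open>t = -1, 0\<close>.\<close>

definition count_fps :: "rat fps" where
  "count_fps = Abs_fps (\<lambda>n. of_nat (sparse_count (n - 2)))"

definition weight_fps :: "(nat \<Rightarrow> rat) \<Rightarrow> rat fps" where
  "weight_fps w = Abs_fps (\<lambda>n. sparse_weight w (n - 2))"

abbreviation (input) denom :: "rat fps" where "denom \<equiv> 1 - fps_X - fps_X ^ 3"
abbreviation (input) denom_neg :: "rat fps" where "denom_neg \<equiv> 1 + fps_X + fps_X ^ 3"

lemma nat_less_3_cases: "(n::nat) = 0 \<or> n = 1 \<or> n = 2 \<or> (\<exists>m. n = m + 3)"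
  by presburger

lemma denom_count_fps: "denom * count_fps = 1"
proof -
  have "count_fps = 1 + fps_X * count_fps + fps_X ^ 3 * count_fps"
  proof (rule fps_ext)
    fix n show "count_fps $ n = (1 + fps_X * count_fps + fps_X ^ 3 * count_fps) $ n"
      using nat_less_3_cases[of n]
      by (auto simp: count_fps_def fps_X_power_mult_nth sparse_count_0 sparse_count_Suc)
  qed
  then show ?thesis by (simp add: algebra_simps)
qed

text \<open>At index \<open>m + 3\<close> the recurrence has the extra term
  \<open>w m * sparse_count (m - 2)\<close>, whose second factor is coefficient \<open>m\<close> of
  \<open>count_fps\<close>; so the weights enter coefficientwise.\<close>

lemma denom_weight_fps:
  "denom * weight_fps w = fps_X ^ 3 * Abs_fps (\<lambda>n. w n * count_fps $ n)"
proof -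
  have "weight_fps w = fps_X * weight_fps w + fps_X ^ 3 * weight_fps w +
      fps_X ^ 3 * Abs_fps (\<lambda>n. w n * count_fps $ n)"
  proof (rule fps_ext)
    fix n
    show "weight_fps w $ n = (fps_X * weight_fps w + fps_X ^ 3 * weight_fps w +
      fps_X ^ 3 * Abs_fps (\<lambda>n. w n * count_fps $ n)) $ n"
      using nat_less_3_cases[of n]
      by (auto simp: count_fps_def weight_fps_def fps_X_power_mult_nth
          sparse_weight_0 sparse_weight_Suc)
  qed
  then show ?thesis by (simp add: algebra_simps)
qed

text \<open>The signs substitute -x for x, and only odd powers of \<open>fps_X\<close> occur in the
  recurrence.\<close>

lemma denom_neg_count_fps: "denom_neg * Abs_fps (\<lambda>n. (-1) ^ n * count_fps $ n) = 1"
proof -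
  let ?Z = "Abs_fps (\<lambda>n. (-1) ^ n * count_fps $ n)"
  have "?Z = 1 - fps_X * ?Z - fps_X ^ 3 * ?Z"
  proof (rule fps_ext)
    fix n show "?Z $ n = (1 - fps_X * ?Z - fps_X ^ 3 * ?Z) $ n"
      using nat_less_3_cases[of n]
      by (auto simp: count_fps_def fps_X_power_mult_nth sparse_count_0 sparse_count_Suc
          power_add algebra_simps) (simp add: numeral_2_eq_2)
  qed
  then show ?thesis by (simp add: algebra_simps)
qed

text \<open>These two weights come from the hook length \<open>2 * zigzag t p + 1\<close> of the box in
  position \<open>p\<close>, which is \<open>p + 1\<close> for even \<open>p\<close> and \<open>2 * t - p\<close> for odd \<open>p\<close>.\<close>

definition odd_indicator :: "nat \<Rightarrow> rat" where
  "odd_indicator p = (if odd p then 1 else 0)"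

definition size_offset :: "nat \<Rightarrow> rat" where
  "size_offset p = (if even p then of_nat p + 1 else - of_nat p)"

text \<open>The bracket is the series for sizes. With \<open>F\<close> and \<open>Z\<close> the
  count series at x and -x, half of \<open>F + Z\<close> and of \<open>F - Z\<close> selects even
  and odd positions; clearing \<open>D\<close> and \<open>E\<close> leaves a polynomial
  identity.\<close>

lemma weight_fps_identity:
  "(weight_fps size_offset + 2 * (fps_X * fps_deriv (weight_fps odd_indicator)
      - weight_fps odd_indicator)) * (denom_neg * denom ^ 3) =
   (1 + 4 * fps_X - fps_X ^ 2 + 6 * fps_X ^ 3 + 4 * fps_X ^ 4 + 5 * fps_X ^ 6) * fps_X ^ 3"
proof -
  define x :: "rat fps" where "x = fps_X"
  define F where "F = count_fps"
  define Z where "Z = Abs_fps (\<lambda>n. (-1) ^ n * count_fps $ n)"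
  define U where "U = weight_fps size_offset"
  define V where "V = weight_fps odd_indicator"
  define V' where "V' = fps_deriv V"
  define Z' where "Z' = fps_deriv Z"
  have F: "(1 - x - x ^ 3) * F = 1"
    using denom_count_fps by (simp add: F_def x_def)
  have Z: "(1 + x + x ^ 3) * Z = 1"
    using denom_neg_count_fps by (simp add: Z_def x_def)
  have dx: "fps_deriv x = 1" by (simp add: x_def)
  have GV: "2 * Abs_fps (\<lambda>n. odd_indicator n * count_fps $ n) = F - Z"
    by (rule fps_ext) (auto simp: F_def Z_def odd_indicator_def fps_numeral_fps_const)
  have V: "2 * ((1 - x - x ^ 3) * V) = x ^ 3 * (F - Z)"
    unfolding GV[symmetric] unfolding V_def x_def denom_weight_fps by (rule mult.left_commute)
  \<comment> \<open>The offset is 1 on even \<open>n\<close> and 0 on odd \<open>n\<close>, plus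
    \<open>(-1) ^ n * n\<close>; the factor \<open>n\<close> becomes \<open>x * Z'\<close>.\<close>
  have GU: "2 * Abs_fps (\<lambda>n. size_offset n * count_fps $ n) = F + Z + 2 * (x * Z')"
    by (rule fps_ext) (auto simp: F_def Z_def Z'_def x_def size_offset_def fps_numeral_fps_const
        algebra_simps)
  have U: "2 * ((1 - x - x ^ 3) * U) = x ^ 3 * (F + Z + 2 * (x * Z'))"
    unfolding GU[symmetric] unfolding U_def x_def denom_weight_fps by (rule mult.left_commute)
  define D where "D = 1 - x - x ^ 3"
  define E where "E = 1 + x + x ^ 3"
  define D1 where "D1 = 1 + 3 * x ^ 2"
  \<comment> \<open>This is \<open>x ^ 3 * (E - D) / 2\<close>.\<close>
  define N where "N = x ^ 4 + x ^ 6"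
  note F = F[folded D_def] and Z = Z[folded E_def]
    and V = V[folded D_def] and U = U[folded D_def]
  have dE: "fps_deriv E = D1" and dD: "fps_deriv D = - D1"
    by (simp_all add: E_def D_def D1_def dx fps_deriv_power fps_numeral_fps_const)
  have dN: "fps_deriv N = 4 * x ^ 3 + 6 * x ^ 5"
    by (simp add: N_def dx fps_deriv_power fps_numeral_fps_const)
  have "2 * (D\<^sup>2 * E * V) = D * E * (2 * (D * V))"
    by algebra
  also have "\<dots> = x ^ 3 * (E * (D * F) - D * (E * Z))"
    unfolding V by algebra
  also have "\<dots> = 2 * N"
    unfolding F Z unfolding D_def E_def N_def by algebra
  finally have V2: "D\<^sup>2 * E * V = N" by simp
  have "fps_deriv (D\<^sup>2 * E * V) = D\<^sup>2 * E * V' + (D - 2 * E) * D1 * D * V"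
    by (simp add: dD dE V'_def fps_deriv_power power2_eq_square algebra_simps)
  then have V3: "D\<^sup>2 * E * V' = 4 * x ^ 3 + 6 * x ^ 5 - (D - 2 * E) * D1 * D * V"
    unfolding V2 dN by (simp add: algebra_simps)
  have "fps_deriv (E * Z) = 0" unfolding Z by simp
  then have "E * Z' + D1 * Z = 0" by (simp add: dE Z'_def)
  then have Z2: "E\<^sup>2 * Z' = - D1" using Z by algebra
  \<comment> \<open>Both \<open>U\<close> (through \<open>Z'\<close>) and \<open>V'\<close> bring in
    the denominator \<open>E\<^sup>2\<close>; the additional \<open>E\<close> clears it and is
    cancelled at the end. The 2 clears the halves.\<close>
  have "2 * E * ((U + 2 * (x * V' - V)) * (E * D ^ 3)) =
      D\<^sup>2 * E\<^sup>2 * (2 * (D * U)) + 4 * x * E * D * (D\<^sup>2 * E * V') - 4 * E * D * (D\<^sup>2 * E * V)"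
    by algebra
  also have "D\<^sup>2 * E\<^sup>2 * (2 * (D * U)) =
      x ^ 3 * (D * E\<^sup>2 * (D * F) + D\<^sup>2 * E * (E * Z) + 2 * x * D\<^sup>2 * (E\<^sup>2 * Z'))"
    unfolding U by algebra
  also have "4 * x * E * D * (D\<^sup>2 * E * V') =
      4 * x * E * D * (4 * x ^ 3 + 6 * x ^ 5) - 4 * x * (D - 2 * E) * D1 * (D\<^sup>2 * E * V)"
    unfolding V3 by algebra
  also have "x ^ 3 * (D * E\<^sup>2 * (D * F) + D\<^sup>2 * E * (E * Z) + 2 * x * D\<^sup>2 * (E\<^sup>2 * Z')) +
      (4 * x * E * D * (4 * x ^ 3 + 6 * x ^ 5) - 4 * x * (D - 2 * E) * D1 * (D\<^sup>2 * E * V)) -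
      4 * E * D * (D\<^sup>2 * E * V) =
      2 * E * ((1 + 4 * x - x ^ 2 + 6 * x ^ 3 + 4 * x ^ 4 + 5 * x ^ 6) * x ^ 3)"
    unfolding F Z Z2 V2 unfolding D_def E_def D1_def N_def by algebra
  finally have "2 * E * ((U + 2 * (x * V' - V)) * (E * D ^ 3)) =
      2 * E * ((1 + 4 * x - x ^ 2 + 6 * x ^ 3 + 4 * x ^ 4 + 5 * x ^ 6) * x ^ 3)" .
  moreover have "2 * E \<noteq> 0" using Z by auto
  ultimately have "(U + 2 * (x * V' - V)) * (E * D ^ 3) =
      (1 + 4 * x - x ^ 2 + 6 * x ^ 3 + 4 * x ^ 4 + 5 * x ^ 6) * x ^ 3"
    using mult_left_cancel by blast
  then show ?thesis
    by (simp only: U_def V'_def V_def E_def D_def x_def)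
qed

section \<open>The zigzag enumeration\<close>

text \<open>Along \<open>0, t - 1, 1, t - 2, 2, \<dots>\<close> consecutive entries have sum \<open>t - 1\<close> or \<open>t\<close>, and
  entries two places apart are consecutive integers. Only the last entry is excluded on its own,
  since its double is \<open>t - 1\<close> or \<open>t\<close>.\<close>

definition zigzag :: "nat \<Rightarrow> nat \<Rightarrow> nat" where
  "zigzag t p = (if even p then p div 2 else t - 1 - p div 2)"

lemma zigzag_cases: "p < t \<Longrightarrow> p = 2 * zigzag t p \<or> p + 2 * zigzag t p + 1 = 2 * t"
  by (cases "even p") (auto simp: zigzag_def elim!: oddE)

text \<open>Same parity: values differ by 1 iff positions differ by 2, and a sum
  \<open>t - 1\<close> or \<open>t\<close> forces \<open>p = q = t - 1\<close>. Opposite parity: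
  such sums mean adjacent positions, and consecutive values occur only at the last two positions,
  which are adjacent anyway.\<close>

lemma zigzag_conflict:
  assumes pq: "p < t" "q < t"
  shows "zigzag t p + zigzag t q = t \<or> Suc (zigzag t p + zigzag t q) = t \<or>
      Suc (zigzag t p) = zigzag t q \<or> Suc (zigzag t q) = zigzag t p \<longleftrightarrow>
    p \<noteq> q \<and> p \<le> q + 2 \<and> q \<le> p + 2 \<or> p = q \<and> Suc p = t"
  using zigzag_cases[OF pq(1)] zigzag_cases[OF pq(2)]
proof (elim disjE, goal_cases)
  case 1
  then show ?case using pq by (intro iffI) (elim disjE conjE, linarith+)+
next
  case 2
  then show ?case using pq by (intro iffI) (elim disjE conjE, linarith+)+
next
  case 3
  then show ?case using pq by (intro iffI) (elim disjE conjE, linarith+)+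
next
  case 4
  then show ?case using pq by (intro iffI) (elim disjE conjE, linarith+)+
qed

lemma bij_betw_zigzag: "bij_betw (zigzag t) {..<t} {..<t}"
proof -
  have "inj_on (zigzag t) {..<t}"
  proof (rule inj_onI)
    fix p q assume pq: "p \<in> {..<t}" "q \<in> {..<t}" "zigzag t p = zigzag t q"
    then have "p < t" "q < t" by auto
    \<comment> \<open>A common value at opposite parities would give
      \<open>p + q + 1 = 2 * t\<close>, too large for positions below \<open>t\<close>.\<close>
    then show "p = q" using zigzag_cases[of p t] zigzag_cases[of q t] pq(3) by linarith
  qed
  moreover have "zigzag t ` {..<t} \<subseteq> {..<t}" by (auto simp: zigzag_def)
  ultimately show ?thesis by (simp add: bij_betw_def endo_inj_surj)
qed

text \<open>Conflicts between distinct positions give the gap of three; the conflict of a position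
  with itself removes \<open>t - 1\<close>, hence the bound.\<close>

lemma admissible_zigzag_iff:
  assumes "S \<subseteq> {..<t}"
  shows "admissible t (zigzag t ` S) \<longleftrightarrow> S \<in> sparse_sets (t - 1)"
proof -
  have "zigzag t ` S \<subseteq> {..<t}"
    using assms bij_betw_zigzag[of t] by (auto simp: bij_betw_def)
  then have "admissible t (zigzag t ` S) \<longleftrightarrow> (\<forall>p\<in>S. \<forall>q\<in>S.
      \<not> (zigzag t p + zigzag t q = t \<or> Suc (zigzag t p + zigzag t q) = t \<or>
      Suc (zigzag t p) = zigzag t q \<or> Suc (zigzag t q) = zigzag t p))"
    unfolding admissible_def by (auto simp: image_iff)
  also have "\<dots> \<longleftrightarrow> (\<forall>p\<in>S. \<forall>q\<in>S.
      \<not> (p \<noteq> q \<and> p \<le> q + 2 \<and> q \<le> p + 2 \<or> p = q \<and> Suc p = t))"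
    using zigzag_conflict assms by (intro ball_cong refl) (metis lessThan_iff subsetD)
  also have "\<dots> \<longleftrightarrow> S \<in> sparse_sets (t - 1)"
  proof
    assume L: "\<forall>p\<in>S. \<forall>q\<in>S. \<not> (p \<noteq> q \<and> p \<le> q + 2 \<and> q \<le> p + 2 \<or> p = q \<and> Suc p = t)"
    have "p < t - 1" if "p \<in> S" for p
    proof -
      have "Suc p \<noteq> t" using L that by blast
      moreover have "p < t" using that assms by blast
      ultimately show ?thesis by linarith
    qed
    moreover have "p + 3 \<le> q" if "p \<in> S" "q \<in> S" "p < q" for p q
    proof -
      have "\<not> (p \<noteq> q \<and> p \<le> q + 2 \<and> q \<le> p + 2)" using L that by blast
      then show ?thesis using \<open>p < q\<close> by linarith
    qed
    ultimately show "S \<in> sparse_sets (t - 1)" by (auto simp: sparse_sets_def)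
  next
    assume S: "S \<in> sparse_sets (t - 1)"
    show "\<forall>p\<in>S. \<forall>q\<in>S. \<not> (p \<noteq> q \<and> p \<le> q + 2 \<and> q \<le> p + 2 \<or> p = q \<and> Suc p = t)"
    proof (intro ballI)
      fix p q assume pq: "p \<in> S" "q \<in> S"
      then have "p < t - 1" "p < q \<longrightarrow> p + 3 \<le> q" "q < p \<longrightarrow> q + 3 \<le> p"
        using S by (auto simp: sparse_sets_def)
      then show "\<not> (p \<noteq> q \<and> p \<le> q + 2 \<and> q \<le> p + 2 \<or> p = q \<and> Suc p = t)"
        by linarith
    qed
  qed
  finally show ?thesis .
qed

lemma bij_betw_image_zigzag:
  "bij_betw (image (zigzag t)) (sparse_sets (t - 1)) {A. admissible t A}"
proof -
  have P: "bij_betw (image (zigzag t)) (Pow {..<t}) (Pow {..<t})"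
    by (rule bij_betw_Pow[OF bij_betw_zigzag])
  have sub: "sparse_sets (t - 1) \<subseteq> Pow {..<t}"
    by (auto simp: sparse_sets_def)
  have "image (zigzag t) ` sparse_sets (t - 1) = {A. admissible t A}"
  proof (intro set_eqI iffI)
    fix A assume "A \<in> {A. admissible t A}"
    then have A: "admissible t A" by simp
    then have "A \<in> Pow {..<t}" by (auto simp: admissible_def)
    then obtain S where "S \<in> Pow {..<t}" "A = zigzag t ` S"
      using P by (metis bij_betw_imp_surj_on imageE)
    with A show "A \<in> image (zigzag t) ` sparse_sets (t - 1)"
      using admissible_zigzag_iff[of S t] by auto
  next
    fix A assume "A \<in> image (zigzag t) ` sparse_sets (t - 1)"
    then obtain S where S: "S \<in> sparse_sets (t - 1)" and A: "A = zigzag t ` S" by blast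
    have "S \<subseteq> {..<t}" using S sub by blast
    with S show "A \<in> {A. admissible t A}" unfolding A by (simp add: admissible_zigzag_iff)
  qed
  then show ?thesis
    using P sub by (auto simp: bij_betw_def intro: inj_on_subset)
qed

section \<open>Transfer of the sums over partitions to sparse sets\<close>

lemma sum_DS:
  assumes "t \<ge> 1"
  shows "(\<Sum>\<mu>\<in>DS t. G (arms \<mu>)) = (\<Sum>S\<in>sparse_sets (t - 1). G (zigzag t ` S))"
  using sum.reindex_bij_betw[OF bij_betw_arms[OF assms], of G]
    sum.reindex_bij_betw[OF bij_betw_image_zigzag[of t], of G] by simp

lemma inj_on_zigzag: "S \<in> sparse_sets (t - 1) \<Longrightarrow> inj_on (zigzag t) S"
  by (rule inj_on_subset[OF bij_betw_imp_inj_on[OF bij_betw_zigzag[of t]]])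
    (auto simp: sparse_sets_def)

text \<open>Splitting off the multiple of \<open>t\<close> leaves weights depending on the position
  alone.\<close>

lemma zigzag_size:
  assumes "p < t"
  shows "rat_of_nat (2 * zigzag t p + 1) = size_offset p + 2 * of_nat t * odd_indicator p"
proof (cases "even p")
  case True
  then show ?thesis by (auto simp: zigzag_def size_offset_def odd_indicator_def elim!: evenE)
next
  case False
  then obtain l where l: "p = 2 * l + 1" by (auto elim: oddE)
  then have "2 * zigzag t p + 1 + p = 2 * t" using assms by (simp add: zigzag_def)
  then have "rat_of_nat (2 * zigzag t p + 1) + of_nat p = 2 * of_nat t"
    by (metis of_nat_add of_nat_mult of_nat_numeral)
  then show ?thesis using False by (simp add: size_offset_def odd_indicator_def)
qed

lemma card_DS: "t \<ge> 1 \<Longrightarrow> card (DS t) = sparse_count (t - 1)"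
  using sum_DS[of t "\<lambda>_. 1 :: nat"] by (simp add: sparse_count_def)

lemma sum_card_MD_DS:
  assumes "t \<ge> 1"
  shows "of_nat (\<Sum>\<mu>\<in>DS t. card (MD \<mu>)) = sparse_weight (\<lambda>_. 1) (t - 1)"
proof -
  have "(\<Sum>\<mu>\<in>DS t. card (MD \<mu>)) = (\<Sum>\<mu>\<in>DS t. card (arms \<mu>))"
    using DS_iff_admissible[OF assms] card_MD by (intro sum.cong) auto
  also have "\<dots> = (\<Sum>S\<in>sparse_sets (t - 1). card S)"
    unfolding sum_DS[OF assms] using inj_on_zigzag by (intro sum.cong) (auto simp: card_image)
  finally show ?thesis by (simp add: sparse_weight_def)
qed

lemma sum_size_DS:
  assumes "t \<ge> 1"
  shows "of_nat (\<Sum>\<mu>\<in>DS t. partition_size \<mu>) =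
    sparse_weight size_offset (t - 1) + 2 * of_nat t * sparse_weight odd_indicator (t - 1)"
proof -
  have "(\<Sum>\<mu>\<in>DS t. partition_size \<mu>) = (\<Sum>\<mu>\<in>DS t. \<Sum>a\<in>arms \<mu>. 2 * a + 1)"
    using DS_iff_admissible[OF assms] partition_size_arms by (intro sum.cong) auto
  also have "\<dots> = (\<Sum>S\<in>sparse_sets (t - 1). \<Sum>p\<in>S. 2 * zigzag t p + 1)"
    unfolding sum_DS[OF assms, of "\<lambda>A. \<Sum>a\<in>A. 2 * a + 1"]
    by (rule sum.cong) (simp_all add: sum.reindex[OF inj_on_zigzag])
  finally have "rat_of_nat (\<Sum>\<mu>\<in>DS t. partition_size \<mu>) =
      (\<Sum>S\<in>sparse_sets (t - 1). \<Sum>p\<in>S. of_nat (2 * zigzag t p + 1))"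
    by simp
  also have "\<dots> = (\<Sum>S\<in>sparse_sets (t - 1). \<Sum>p\<in>S.
      size_offset p + 2 * of_nat t * odd_indicator p)"
    by (intro sum.cong refl zigzag_size) (fastforce dest: sparse_setsD)
  also have "\<dots> = sparse_weight size_offset (t - 1) +
      2 * of_nat t * sparse_weight odd_indicator (t - 1)"
    by (simp add: sparse_weight_def sum.distrib sum_distrib_left)
  finally show ?thesis .
qed

lemma f_DS_eq: "f_DS (int n - 1) = sparse_count (n - 2)"
  by (cases "n \<ge> 2") (auto simp: f_DS_def card_DS nat_diff_distrib' sparse_count_0 numeral_2_eq_2)

lemma g_DS_eq: "of_nat (g_DS (int n - 1)) = sparse_weight (\<lambda>_. 1) (n - 2)"
proof (cases "n \<ge> 2")
  case True
  then show ?thesis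
    using sum_card_MD_DS[of "n - 1"] by (simp add: g_DS_def nat_diff_distrib' numeral_2_eq_2)
qed (simp add: g_DS_def sparse_weight_0)

text \<open>The multiplier \<open>n - 1\<close> is \<open>t\<close>. For \<open>n < 2\<close> both
  weights vanish, matching the conventional zeros.\<close>

lemma h_DS_eq:
  "of_nat (h_DS (int n - 1)) =
   sparse_weight size_offset (n - 2) + 2 * (of_nat n - 1) * sparse_weight odd_indicator (n - 2)"
proof (cases "n \<ge> 2")
  case True
  then show ?thesis
    using sum_size_DS[of "n - 1"]
    by (simp add: h_DS_def nat_diff_distrib' numeral_2_eq_2 of_nat_diff)
qed (simp add: h_DS_def sparse_weight_0)

lemma fps_eq_divideI:
  fixes a b c :: "rat fps"
  assumes "a * c = b" "c \<noteq> 0"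
  shows "a = b / c"
  using assms by (metis nonzero_mult_div_cancel_right)

lemma f_DS_fps: "Abs_fps (\<lambda>n. rat_of_nat (f_DS (int n - 1))) = count_fps"
  by (simp add: f_DS_eq count_fps_def)

lemma g_DS_fps: "Abs_fps (\<lambda>n. rat_of_nat (g_DS (int n - 1))) = weight_fps (\<lambda>_. 1)"
  by (simp add: g_DS_eq weight_fps_def)

text \<open>The operator x d/dx - 1 multiplies coefficient \<open>n\<close> by \<open>n - 1\<close>,
  which supplies the dependence on \<open>t\<close>.\<close>

lemma h_DS_fps:
  "Abs_fps (\<lambda>n. rat_of_nat (h_DS (int n - 1))) = weight_fps size_offset +
     2 * (fps_X * fps_deriv (weight_fps odd_indicator) - weight_fps odd_indicator)"
proof (rule fps_ext)
  fix n
  show "Abs_fps (\<lambda>n. rat_of_nat (h_DS (int n - 1))) $ n = (weight_fps size_offset +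
     2 * (fps_X * fps_deriv (weight_fps odd_indicator) - weight_fps odd_indicator)) $ n"
    by (cases n) (auto simp: h_DS_eq weight_fps_def fps_numeral_fps_const sparse_weight_0
        algebra_simps)
qed

theorem theorem1p2:
  shows "(f_DS 1 = 1 \<and> f_DS 2 = 2 \<and>
          (\<forall>t\<ge>3. f_DS t = f_DS (t - 1) + f_DS (t - 3)) \<and>
          Abs_fps (\<lambda>n. rat_of_nat (f_DS (int n - 1))) = 1 / (1 - fps_X - fps_X ^ 3))
       \<and> (g_DS 1 = 0 \<and> g_DS 2 = 1 \<and>
          Abs_fps (\<lambda>n. rat_of_nat (g_DS (int n - 1))) = fps_X ^ 3 / (1 - fps_X - fps_X ^ 3) ^ 2)
       \<and> (h_DS 1 = 0 \<and> h_DS 2 = 1 \<and>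
          Abs_fps (\<lambda>n. rat_of_nat (h_DS (int n - 1))) =
            (1 + 4 * fps_X - fps_X ^ 2 + 6 * fps_X ^ 3 + 4 * fps_X ^ 4 + 5 * fps_X ^ 6) * fps_X ^ 3 /
            ((1 + fps_X + fps_X ^ 3) * (1 - fps_X - fps_X ^ 3) ^ 3))"
proof (intro conjI allI impI)
  have nz: "denom \<noteq> 0" "denom_neg \<noteq> 0"
    using denom_count_fps denom_neg_count_fps by (metis mult_zero_left zero_neq_one)+
  show "f_DS 1 = 1" using f_DS_eq[of 2] by (simp add: sparse_count_0)
  show "f_DS 2 = 2" using f_DS_eq[of 3] by (simp add: sparse_count_0 sparse_count_Suc)
  show "g_DS 1 = 0" using g_DS_eq[of 2] by (simp add: sparse_weight_0)
  show "g_DS 2 = 1" using g_DS_eq[of 3]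
    by (simp add: sparse_weight_0 sparse_weight_Suc sparse_count_0)
  show "h_DS 1 = 0" using h_DS_eq[of 2] by (simp add: sparse_weight_0)
  show "h_DS 2 = 1" using h_DS_eq[of 3]
    by (simp add: sparse_weight_0 sparse_weight_Suc sparse_count_0 size_offset_def odd_indicator_def)
  show "f_DS t = f_DS (t - 1) + f_DS (t - 3)" if "t \<ge> 3" for t
  proof -
    \<comment> \<open>For \<open>m = 0\<close> the last term is the conventional value at 0, which
      the truncated \<open>sparse_count (m - 1)\<close> reproduces.\<close>
    obtain m where m: "t = 3 + int m" using \<open>t \<ge> 3\<close> by (metis zle_iff_zadd)
    show ?thesis
      using f_DS_eq[of "m + 4"] f_DS_eq[of "m + 3"] f_DS_eq[of "m + 1"]
        sparse_count_Suc[of "m + 1"]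
      by (simp add: m)
  qed
  show "Abs_fps (\<lambda>n. rat_of_nat (f_DS (int n - 1))) = 1 / denom"
    unfolding f_DS_fps using denom_count_fps nz by (intro fps_eq_divideI) (simp_all add: mult.commute)
  \<comment> \<open>Weight 1 turns the coefficientwise product into \<open>count_fps\<close> itself,
    so one more factor \<open>denom\<close> clears it.\<close>
  have "denom * weight_fps (\<lambda>_. 1) = fps_X ^ 3 * count_fps"
    unfolding denom_weight_fps by (simp add: fps_nth_inverse)
  then have "weight_fps (\<lambda>_. 1) * denom ^ 2 = fps_X ^ 3 * (denom * count_fps)"
    by algebra
  then show "Abs_fps (\<lambda>n. rat_of_nat (g_DS (int n - 1))) = fps_X ^ 3 / denom ^ 2"
    unfolding g_DS_fps denom_count_fps using nz by (intro fps_eq_divideI) simp_all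
  show "Abs_fps (\<lambda>n. rat_of_nat (h_DS (int n - 1))) =
      (1 + 4 * fps_X - fps_X ^ 2 + 6 * fps_X ^ 3 + 4 * fps_X ^ 4 + 5 * fps_X ^ 6) * fps_X ^ 3 /
      (denom_neg * denom ^ 3)"
    unfolding h_DS_fps using weight_fps_identity nz by (intro fps_eq_divideI) simp_all
qed

end
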